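(* Let $G$ be a countable group with a finite symmetric generating set $S$, let $\mathbb{G}=(V,E)$ be the associated Cayley graph, and let $\mathcal{R}$ be the cluster equivalence relation on $X=2^E$. Let $\mu$ be a Borel probability measure on $X$. If $\mu$ is $\mathcal{R}$-quasi-invariant, $\mathcal{R}$-ergodic and insertion-tolerant, then every closed $\mathcal{R}$-minimal set $Z\subset X$ satisfies either $Z=\{E\}$ or $\mu(Z)=0$.
   Context: Cayley graph: $V=G$ and $E=\{(g,h)\in G\times G : hg^{-1}\in S\}$. Since $S$ is symmetric, $E$ is a symmetric relation and $\mathbb{G}$ is regarded as an undirected graph. $G$ acts on the right on $E$ by diagonal right multiplication. $2^E$ is the set of all subsets of $E$ with the product topology and its Borel $\sigma$-algebra. $G$ acts on it on the left by homeomorphisms, $g.\omega=\omega g^{-1}$. For $\omega\in 2^E$, $C_1(\omega)$ is the connected component (cluster) containing the identity $1\in G$ of the graph $(G,\omega)$ with vertex set $G$ and edge set $\omega$ (connectivity ignores orientation of edges); membership of $g\in G$ in $C_1(\omega)$ means that $g$ is a vertex of it. Cluster equivalence relation: $\mathcal{R}=\{(\omega,\omega')\in 2^E\times 2^E : \exists\, g\in C_1(\omega),\ \omega'=g.\omega\}$. It is a countable Borel equivalence relation. $\mathcal{R}[\omega]$ denotes the class of $\omega$, and $\mathcal{R}[B]=\bigcup_{\omega\in B}\mathcal{R}[\omega]$ for $B\subset X$. Quasi-invariance: $\mu$ is $\mathcal{R}$-quasi-invariant if for every partial transformation $\varphi:A\to B$ of $\mathcal{R}$ (a measurable bijection between Borel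 sets whose graph is contained in $\mathcal{R}$) and every Borel $A'\subset A$, $\mu(A')=0$ if and only if $\mu(\varphi(A'))=0$. Ergodicity: $\mu$ is $\mathcal{R}$-ergodic if $\mu(\mathcal{R}[B])\in\{0,1\}$ for every Borel set $B\subset X$. Insertion-tolerance: $\mu$ is insertion-tolerant if for every finite symmetric set $F\subset E$ the map $i_F:2^E\to 2^E$, $i_F(\omega)=\omega\cup F$, satisfies $\mu(i_F(B))>0$ for every Borel set $B$ with $\mu(B)>0$. Minimality: a closed subset $Z\subset X$ is $\mathcal{R}$-minimal if for every $\omega\in Z$ the class $\mathcal{R}[\omega]$ is contained in $Z$ and dense in $Z$. *)

theory Defs
  imports "HOL-Algebra.Generated_Groups" "HOL-Probability.Probability_Measure"
begin

definition cayley_edges :: "('a, 'b) monoid_scheme \<Rightarrow> 'a set \<Rightarrow> ('a \<times> 'a) set" where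
  "cayley_edges G S = {(g, h) \<in> carrier G \<times> carrier G. h \<otimes>\<^bsub>G\<^esub> inv\<^bsub>G\<^esub> g \<in> S}"

text \<open>The product topology on the power set of \<open>E\<close>, obtained by identifying a subset of \<open>E\<close>
  with its indicator function; the underlying set is \<^term>\<open>Pow E\<close>.\<close>

definition config_topology :: "'e set \<Rightarrow> 'e set topology" where
  "config_topology E = pullback_topology (Pow E) (\<lambda>\<omega>. \<lambda>e\<in>E. e \<in> \<omega>)
     (product_topology (\<lambda>_. discrete_topology (UNIV :: bool set)) E)"

definition config_borel :: "'e set \<Rightarrow> 'e set measure" where
  "config_borel E = sigma (Pow E) {U. openin (config_topology E) U}"

text \<open>The left action \<open>g.\<omega> = \<omega> g\<inverse>\<close> induced by diagonal right multiplication on edges.\<close>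

definition config_act :: "('a, 'b) monoid_scheme \<Rightarrow> 'a \<Rightarrow> ('a \<times> 'a) set \<Rightarrow> ('a \<times> 'a) set" where
  "config_act G g \<omega> = (\<lambda>(a, b). (a \<otimes>\<^bsub>G\<^esub> inv\<^bsub>G\<^esub> g, b \<otimes>\<^bsub>G\<^esub> inv\<^bsub>G\<^esub> g)) ` \<omega>"

definition identity_cluster :: "('a, 'b) monoid_scheme \<Rightarrow> ('a \<times> 'a) set \<Rightarrow> 'a set" where
  "identity_cluster G \<omega> = {g \<in> carrier G. (\<one>\<^bsub>G\<^esub>, g) \<in> (\<omega> \<union> \<omega>\<inverse>)\<^sup>*}"

text \<open>For this relation \<open>R\<close>, the class of \<open>\<omega>\<close> is \<^term>\<open>R `` {\<omega>}\<close>, and the saturation of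
  \<open>B\<close> is \<^term>\<open>R `` B\<close>.\<close>

definition cluster_rel :: "('a, 'b) monoid_scheme \<Rightarrow> 'a set \<Rightarrow> ('a \<times> 'a) set rel" where
  "cluster_rel G S = {(\<omega>, \<omega>') \<in> Pow (cayley_edges G S) \<times> Pow (cayley_edges G S).
     \<exists>g \<in> identity_cluster G \<omega>. \<omega>' = config_act G g \<omega>}"

definition partial_transformation ::
    "'x measure \<Rightarrow> 'x rel \<Rightarrow> ('x \<Rightarrow> 'x) \<Rightarrow> 'x set \<Rightarrow> 'x set \<Rightarrow> bool" where
  "partial_transformation M R \<phi> A B \<longleftrightarrow>
     A \<in> sets M \<and> B \<in> sets M \<and> bij_betw \<phi> A B \<and>
     \<phi> \<in> restrict_space M A \<rightarrow>\<^sub>M restrict_space M B \<and>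
     (\<forall>x\<in>A. (x, \<phi> x) \<in> R)"

text \<open>In the next three definitions the sets \<open>\<phi> ` A'\<close>, \<open>R `` B\<close> and \<open>(\<lambda>\<omega>. \<omega> \<union> F) ` B\<close> are
  automatically Borel when \<open>R\<close> is the cluster relation of a countable group, so the
  convention that \<^const>\<open>emeasure\<close> vanishes on non-measurable sets plays no role.\<close>

definition quasi_invariant :: "'x measure \<Rightarrow> 'x rel \<Rightarrow> bool" where
  "quasi_invariant M R \<longleftrightarrow>
     (\<forall>\<phi> A B. partial_transformation M R \<phi> A B \<longrightarrow>
       (\<forall>A'\<in>sets M. A' \<subseteq> A \<longrightarrow> (emeasure M A' = 0 \<longleftrightarrow> emeasure M (\<phi> ` A') = 0)))"

definition rel_ergodic :: "'x measure \<Rightarrow> 'x rel \<Rightarrow> bool" where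
  "rel_ergodic M R \<longleftrightarrow> (\<forall>B\<in>sets M. emeasure M (R `` B) \<in> {0, 1})"

definition insertion_tolerant :: "('a \<times> 'a) set \<Rightarrow> ('a \<times> 'a) set measure \<Rightarrow> bool" where
  "insertion_tolerant E M \<longleftrightarrow>
     (\<forall>F. finite F \<and> F \<subseteq> E \<and> sym F \<longrightarrow>
       (\<forall>B\<in>sets M. emeasure M B > 0 \<longrightarrow> emeasure M ((\<lambda>\<omega>. \<omega> \<union> F) ` B) > 0))"

text \<open>The empty set satisfies this definition vacuously.\<close>

definition closed_minimal :: "'x topology \<Rightarrow> 'x rel \<Rightarrow> 'x set \<Rightarrow> bool" where
  "closed_minimal T R Z \<longleftrightarrow>
     closedin T Z \<and> (\<forall>\<omega>\<in>Z. R `` {\<omega>} \<subseteq> Z \<and> Z \<subseteq> T closure_of (R `` {\<omega>}))"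

end

theory Submission
  imports Defs
begin

text \<open>
  A closed minimal set \<open>Z\<close> is a union of \<open>R\<close>-classes, so ergodicity leaves only
  \<open>\<mu> Z = 0\<close> and \<open>\<mu> Z = 1\<close>. Suppose \<open>\<mu> Z = 1\<close>. For each finite symmetric set of edges \<open>F\<close>,
  insertion-tolerance gives the set of all \<open>\<omega> \<union> F\<close> with \<open>\<omega> \<in> Z\<close> positive measure, so it
  cannot miss the conull set \<open>Z\<close>. Hence \<open>Z\<close> contains configurations in which any prescribed
  finite set of edges is open. These accumulate at the full configuration \<open>E\<close>, and \<open>Z\<close> is
  closed, so \<open>E \<in> Z\<close> (lemma \<open>full_config_in_closed\<close>). Translations fix \<open>E\<close>, so its class is
  the single point \<open>E\<close> (lemma \<open>cluster_class_full_config\<close>); this class must be dense in \<open>Z\<close>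
  and points are closed, whence \<open>Z = {E}\<close>.
\<close>

lemma topspace_config_topology [simp]: "topspace (config_topology E) = Pow E"
  by (auto simp: config_topology_def topspace_pullback_topology)

lemma openin_config_closed_edge:
  assumes "e \<in> E"
  shows "openin (config_topology E) {\<omega> \<in> Pow E. e \<notin> \<omega>}"
proof -
  let ?T = "product_topology (\<lambda>_. discrete_topology (UNIV :: bool set)) E"
  have "openin ?T {x \<in> topspace ?T. x e \<in> {False}}"
    by (rule openin_continuous_map_preimage[OF continuous_map_product_projection])
      (use assms in auto)
  moreover have "{\<omega> \<in> Pow E. e \<notin> \<omega>} =
      (\<lambda>\<omega>. \<lambda>e\<in>E. e \<in> \<omega>) -` {x \<in> topspace ?T. x e \<in> {False}} \<inter> Pow E"
    using assms by auto
  ultimately show ?thesis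
    unfolding config_topology_def openin_pullback_topology by blast
qed

lemma closure_of_full_config: "config_topology E closure_of {E} \<subseteq> {E}"
proof
  fix \<omega> assume \<omega>: "\<omega> \<in> config_topology E closure_of {E}"
  have "\<omega> \<subseteq> E"
    using \<omega> closure_of_subset_topspace[of "config_topology E" "{E}"] by auto
  moreover have "e \<in> \<omega>" if "e \<in> E" for e
  proof (rule ccontr)
    assume "e \<notin> \<omega>"
    with \<open>\<omega> \<subseteq> E\<close> have "\<omega> \<in> {\<omega> \<in> Pow E. e \<notin> \<omega>}" by simp
    then have "E \<in> {\<omega> \<in> Pow E. e \<notin> \<omega>}"
      using \<omega> openin_config_closed_edge[OF \<open>e \<in> E\<close>]
      unfolding in_closure_of singleton_iff bex_simps by metis
    with \<open>e \<in> E\<close> show False by simp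
  qed
  ultimately show "\<omega> \<in> {E}" by blast
qed

text \<open>A neighbourhood of \<open>E\<close> in the product topology constrains only finitely many edges, and
  at \<open>E\<close> itself the constraint can only be that some of these edges are open.\<close>

lemma full_config_in_closed:
  assumes closed: "closedin (config_topology E) Z"
    and meets: "\<And>F. finite F \<Longrightarrow> F \<subseteq> E \<Longrightarrow> \<exists>\<omega>\<in>Z. F \<subseteq> \<omega>"
  shows "E \<in> Z"
proof (rule ccontr)
  assume "E \<notin> Z"
  let ?f = "\<lambda>\<omega>. \<lambda>e\<in>E. e \<in> \<omega>"
  let ?T = "product_topology (\<lambda>_. discrete_topology (UNIV :: bool set)) E"
  have ZE: "Z \<subseteq> Pow E"
    using closedin_subset[OF closed] by simp
  have "openin (config_topology E) (Pow E - Z)"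
    using closed by (simp add: closedin_def)
  then obtain W where W: "openin ?T W" "Pow E - Z = ?f -` W \<inter> Pow E"
    unfolding config_topology_def openin_pullback_topology by blast
  have "?f E \<in> W"
    using W(2) \<open>E \<notin> Z\<close> by blast
  then obtain U where fin: "finite {e \<in> E. U e \<noteq> UNIV}"
    and E_U: "?f E \<in> Pi\<^sub>E E U" and U_W: "Pi\<^sub>E E U \<subseteq> W"
    using W(1) unfolding openin_product_topology_alt by auto
  obtain \<omega> where "\<omega> \<in> Z" and sup: "{e \<in> E. U e \<noteq> UNIV} \<subseteq> \<omega>"
    using meets[OF fin] by blast
  have "(e \<in> \<omega>) \<in> U e" if "e \<in> E" for e
  proof (cases "U e = UNIV")
    case False
    then have "e \<in> \<omega>" using sup that by blast
    then show ?thesis using PiE_mem[OF E_U that] that by simp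
  qed simp
  then have "?f \<omega> \<in> Pi\<^sub>E E U" by auto
  then have "\<omega> \<in> Pow E - Z"
    using W(2) U_W \<open>\<omega> \<in> Z\<close> ZE by blast
  with \<open>\<omega> \<in> Z\<close> show False by blast
qed

lemma closedin_config_measurable:
  assumes "closedin (config_topology E) Z"
  shows "Z \<in> sets (config_borel E)"
proof -
  let ?M = "config_borel E"
  have sub: "{U. openin (config_topology E) U} \<subseteq> Pow (Pow E)"
    using openin_subset[of "config_topology E"] by auto
  have "space ?M = Pow E"
    unfolding config_borel_def by (rule space_measure_of[OF sub])
  moreover have "Pow E - Z \<in> sets ?M"
    unfolding config_borel_def sets_measure_of[OF sub]
    using assms by (intro sigma_sets.Basic) (simp add: closedin_def)
  moreover have "Z \<subseteq> Pow E"
    using closedin_subset[OF assms] by simp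
  ultimately show ?thesis
    using sets.compl_sets[of "Pow E - Z" ?M] by (simp add: double_diff)
qed

lemma (in group) sym_cayley_edges:
  assumes "\<And>s. s \<in> S \<Longrightarrow> inv s \<in> S"
  shows "sym (cayley_edges G S)"
proof (rule symI)
  fix g h assume gh: "(g, h) \<in> cayley_edges G S"
  then have "inv (h \<otimes> inv g) = g \<otimes> inv h"
    by (simp add: cayley_edges_def inv_mult_group)
  with gh assms[of "h \<otimes> inv g"] show "(h, g) \<in> cayley_edges G S"
    by (simp add: cayley_edges_def)
qed

lemma (in group) cayley_edges_right_mult:
  assumes "(a, b) \<in> cayley_edges G S" and "g \<in> carrier G"
  shows "(a \<otimes> g, b \<otimes> g) \<in> cayley_edges G S"
proof -
  have ab: "a \<in> carrier G" "b \<in> carrier G" "b \<otimes> inv a \<in> S"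
    using assms(1) by (auto simp: cayley_edges_def)
  have "g \<otimes> (inv g \<otimes> inv a) = inv a"
    using ab(1) assms(2) by (simp flip: m_assoc)
  then have "(b \<otimes> g) \<otimes> inv (a \<otimes> g) = b \<otimes> inv a"
    using ab(1,2) assms(2) by (simp add: inv_mult_group m_assoc)
  then show ?thesis
    using ab assms(2) by (simp add: cayley_edges_def)
qed

lemma (in group) config_act_full_config:
  assumes g: "g \<in> carrier G"
  shows "config_act G g (cayley_edges G S) = cayley_edges G S"
proof
  show "config_act G g (cayley_edges G S) \<subseteq> cayley_edges G S"
    using cayley_edges_right_mult[OF _ inv_closed[OF g]] by (auto simp: config_act_def)
next
  show "cayley_edges G S \<subseteq> config_act G g (cayley_edges G S)"
  proof clarify
    fix a b assume ab: "(a, b) \<in> cayley_edges G S"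
    then have "(a, b) = (a \<otimes> g \<otimes> inv g, b \<otimes> g \<otimes> inv g)"
      using g by (simp add: cayley_edges_def m_assoc)
    with cayley_edges_right_mult[OF ab g]
    show "(a, b) \<in> config_act G g (cayley_edges G S)"
      unfolding config_act_def by (force intro: rev_image_eqI)
  qed
qed

lemma (in group) cluster_class_full_config:
  "cluster_rel G S `` {cayley_edges G S} \<subseteq> {cayley_edges G S}"
  using config_act_full_config by (auto simp: cluster_rel_def identity_cluster_def)

lemma (in group) cluster_rel_refl:
  assumes "\<omega> \<subseteq> cayley_edges G S"
  shows "(\<omega>, \<omega>) \<in> cluster_rel G S"
proof -
  have "config_act G \<one> \<omega> = (\<lambda>e. e) ` \<omega>"
    unfolding config_act_def
    using assms by (intro image_cong) (auto simp: cayley_edges_def)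
  then show ?thesis
    using assms by (auto simp: cluster_rel_def identity_cluster_def intro!: bexI[of _ \<one>])
qed

text \<open>An ergodic measure sees a saturated set as null or conull, and insertion cannot carry a
  conull set into a null one.\<close>

lemma insertion_meets_saturated:
  assumes prob: "prob_space M"
    and erg: "rel_ergodic M R"
    and ins: "insertion_tolerant E M"
    and Z: "Z \<in> sets M" "R `` Z = Z" "emeasure M Z \<noteq> 0"
    and F: "finite F" "F \<subseteq> E" "sym F"
  shows "\<exists>\<omega>\<in>Z. F \<subseteq> \<omega>"
proof (rule ccontr)
  assume none: "\<not> (\<exists>\<omega>\<in>Z. F \<subseteq> \<omega>)"
  interpret prob_space M by (rule prob)
  let ?I = "(\<lambda>\<omega>. \<omega> \<union> F) ` Z"
  have "emeasure M Z = 1"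
    using erg Z unfolding rel_ergodic_def by force
  then have "emeasure M (space M - Z) = 0"
    using Z(1) by (simp add: emeasure_compl emeasure_space_1)
  moreover have pos: "emeasure M ?I > 0"
    using ins F Z(1,3) unfolding insertion_tolerant_def by (auto simp: zero_less_iff_neq_zero)
  moreover have "?I \<subseteq> space M - Z"
  proof -
    \<comment> \<open>The measure of a set outside the \<open>\<sigma>\<close>-algebra is \<open>0\<close> by convention, so positivity
      forces measurability.\<close>
    have "?I \<in> sets M"
      using pos emeasure_notin_sets[of ?I M] by (metis less_irrefl)
    then have "?I \<subseteq> space M" by (rule sets.sets_into_space)
    then show ?thesis using none by blast
  qed
  ultimately show False
    using emeasure_mono[of ?I "space M - Z" M] Z(1) by auto
qed

theorem theorem3p1:
  fixes G :: "('a, 'b) monoid_scheme"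
    and S :: "'a set"
    and \<mu> :: "('a \<times> 'a) set measure"
    and Z :: "('a \<times> 'a) set set"
  assumes "group G"
    and "countable (carrier G)"
    and "finite S" and "S \<subseteq> carrier G"
    and "\<And>s. s \<in> S \<Longrightarrow> inv\<^bsub>G\<^esub> s \<in> S"
    and "generate G S = carrier G"
    and "prob_space \<mu>"
    and "sets \<mu> = sets (config_borel (cayley_edges G S))"
    and "quasi_invariant \<mu> (cluster_rel G S)"
    and "rel_ergodic \<mu> (cluster_rel G S)"
    and "insertion_tolerant (cayley_edges G S) \<mu>"
    and "closed_minimal (config_topology (cayley_edges G S)) (cluster_rel G S) Z"
  shows "Z = {cayley_edges G S} \<or> emeasure \<mu> Z = 0"
proof (rule disjCI)
  let ?E = "cayley_edges G S"
  let ?R = "cluster_rel G S"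
  let ?T = "config_topology ?E"
  interpret group G by (rule assms(1))
  assume pos: "emeasure \<mu> Z \<noteq> 0"
  have closed: "closedin ?T Z"
    and inv: "\<And>\<omega>. \<omega> \<in> Z \<Longrightarrow> ?R `` {\<omega>} \<subseteq> Z"
    and dense: "\<And>\<omega>. \<omega> \<in> Z \<Longrightarrow> Z \<subseteq> ?T closure_of (?R `` {\<omega>})"
    using assms(12) unfolding closed_minimal_def by blast+
  have sat: "?R `` Z = Z"
  proof
    show "?R `` Z \<subseteq> Z" using inv by auto
    show "Z \<subseteq> ?R `` Z"
    proof
      fix \<omega> assume "\<omega> \<in> Z"
      moreover from this have "\<omega> \<subseteq> ?E"
        using closedin_subset[OF closed] by auto
      ultimately show "\<omega> \<in> ?R `` Z"
        by (intro ImageI[OF cluster_rel_refl])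
    qed
  qed
  have meas: "Z \<in> sets \<mu>"
    using closedin_config_measurable[OF closed] assms(8) by simp
  have sym: "sym ?E"
    by (rule sym_cayley_edges) (rule assms(5))
  have "?E \<in> Z"
  proof (rule full_config_in_closed[OF closed])
    fix F assume F: "finite F" "F \<subseteq> ?E"
    \<comment> \<open>Insertion-tolerance speaks of symmetric sets only, so \<open>F\<close> is symmetrized inside \<open>E\<close>.\<close>
    have "F \<union> F\<inverse> \<subseteq> ?E"
      using F(2) sym by (auto dest: symD)
    then have "\<exists>\<omega>\<in>Z. F \<union> F\<inverse> \<subseteq> \<omega>"
      using F(1)
      by (intro insertion_meets_saturated[OF assms(7,10,11) meas sat pos])
        (simp_all add: sym_Un_converse)
    then show "\<exists>\<omega>\<in>Z. F \<subseteq> \<omega>" by blast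
  qed
  have "Z \<subseteq> ?T closure_of {?E}"
    using dense[OF \<open>?E \<in> Z\<close>] closure_of_mono[OF cluster_class_full_config] by blast
  then have "Z \<subseteq> {?E}"
    using closure_of_full_config by blast
  with \<open>?E \<in> Z\<close> show "Z = {?E}" by blast
qed

end
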